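(* If $\varphi$ is a Finsler norm in $\mathbb{R}^{d}$, then $$-G_{\varphi}^{*}(D\varphi,D^{2}\varphi)\ge0\quad\text{in the viscosity sense in }\mathbb{R}^{d}\setminus\{0\};$$ that is, whenever $x_0\in\mathbb{R}^d\setminus\{0\}$, $\eta$ is a smooth function defined in a neighborhood of $x_0$, and $\varphi-\eta$ has a local minimum at $x_0$, then $-G_{\varphi}^{*}(D\eta(x_0),D^{2}\eta(x_0))\ge0$.
   Context: A Finsler norm in $\mathbb{R}^d$ is a convex function $\varphi:\mathbb{R}^d\to[0,+\infty)$ with $\varphi(\lambda x)=\lambda\varphi(x)$ for all $\lambda>0$ and $\varphi(x)>0$ for $x\ne0$ (no symmetry is assumed). Its dual norm is $\varphi^{*}(p)=\max\{\langle p,q\rangle : \varphi(q)\le1\}$, and $\partial\varphi^{*}$ is the subdifferential of the convex function $\varphi^{*}$. For $p\in\mathbb{R}^d$ and a symmetric $d\times d$ matrix $X$, $G_{\varphi}^{*}(p,X)=\max\{\langle Xq,q\rangle: q\in\partial\varphi^{*}(p)\}$. *)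

theory Defs
  imports "HOL-Analysis.Analysis"
begin

definition finsler_norm :: "(real^'n \<Rightarrow> real) \<Rightarrow> bool" where
  "finsler_norm \<phi> \<longleftrightarrow>
     convex_on UNIV \<phi> \<and>
     (\<forall>x. 0 \<le> \<phi> x) \<and>
     (\<forall>c x. 0 < c \<longrightarrow> \<phi> (c *\<^sub>R x) = c * \<phi> x) \<and>
     (\<forall>x. x \<noteq> 0 \<longrightarrow> 0 < \<phi> x)"

(* The maxima in dual_norm and Gstar are written as suprema; for a Finsler norm they are
   attained, see dual_norm_attained and Gstar_attained. *)
definition dual_norm :: "(real^'n \<Rightarrow> real) \<Rightarrow> real^'n \<Rightarrow> real" where
  "dual_norm \<phi> p = (SUP q\<in>{q. \<phi> q \<le> 1}. p \<bullet> q)"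

definition subdifferential :: "(real^'n \<Rightarrow> real) \<Rightarrow> real^'n \<Rightarrow> (real^'n) set" where
  "subdifferential f p = {q. \<forall>p'. f p + q \<bullet> (p' - p) \<le> f p'}"

definition Gstar :: "(real^'n \<Rightarrow> real) \<Rightarrow> real^'n \<Rightarrow> real^'n^'n \<Rightarrow> real" where
  "Gstar \<phi> p X = (SUP q\<in>subdifferential (dual_norm \<phi>) p. (X *v q) \<bullet> q)"

definition gradient :: "(real^'n \<Rightarrow> real) \<Rightarrow> real^'n \<Rightarrow> real^'n" where
  "gradient f x = (THE D. GDERIV f x :> D)"

definition hessian :: "(real^'n \<Rightarrow> real) \<Rightarrow> real^'n \<Rightarrow> real^'n^'n" where
  "hessian f x = jacobian (gradient f) (at x)"

(* Ck_on k f U expresses that f is k times continuously differentiable, for open U;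
   derivatives are total (Frechet) derivatives, taken componentwise from order two on. *)
fun Ck_on :: "nat \<Rightarrow> (real^'n \<Rightarrow> real) \<Rightarrow> (real^'n) set \<Rightarrow> bool" where
  "Ck_on 0 f U \<longleftrightarrow> continuous_on U f"
| "Ck_on (Suc k) f U \<longleftrightarrow>
     (\<exists>g. (\<forall>x\<in>U. GDERIV f x :> g x) \<and> (\<forall>i. Ck_on k (\<lambda>x. g x $ i) U))"

definition smooth_on :: "(real^'n \<Rightarrow> real) \<Rightarrow> (real^'n) set \<Rightarrow> bool" where
  "smooth_on f U \<longleftrightarrow> (\<forall>k. Ck_on k f U)"

definition has_local_min_at :: "(real^'n \<Rightarrow> real) \<Rightarrow> real^'n \<Rightarrow> bool" where
  "has_local_min_at f x \<longleftrightarrow> (\<forall>\<^sub>F y in nhds x. f x \<le> f y)"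

(* F (Du, D^2 u) \<ge> 0 in the viscosity sense in \<Omega>. A test function is a total function
   of which only the values on a neighbourhood U of the touching point matter. *)
definition viscosity_nonneg ::
  "(real^'n \<Rightarrow> real^'n^'n \<Rightarrow> real) \<Rightarrow> (real^'n \<Rightarrow> real) \<Rightarrow> (real^'n) set \<Rightarrow> bool" where
  "viscosity_nonneg F u \<Omega> \<longleftrightarrow>
     (\<forall>x\<^sub>0\<in>\<Omega>. \<forall>\<eta> U. open U \<and> x\<^sub>0 \<in> U \<and> smooth_on \<eta> U \<and>
        has_local_min_at (\<lambda>x. u x - \<eta> x) x\<^sub>0 \<longrightarrow>
        0 \<le> F (gradient \<eta> x\<^sub>0) (hessian \<eta> x\<^sub>0))"

lemma gradient_eqI:
  assumes "GDERIV f x :> D"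
  shows "gradient f x = D"
  unfolding gradient_def
proof (rule the_equality, rule assms)
  fix E assume "GDERIV f x :> E"
  then have "(\<lambda>h. h \<bullet> E) = (\<lambda>h. h \<bullet> D)"
    using assms unfolding gderiv_def by (rule has_derivative_unique)
  then show "E = D" unfolding fun_eq_iff vector_eq_ldot .
qed

lemma finsler_norm_zero:
  assumes "finsler_norm \<phi>"
  shows "\<phi> 0 = 0"
proof -
  have "\<phi> (2 *\<^sub>R 0) = 2 * \<phi> 0"
    using assms unfolding finsler_norm_def by (metis zero_less_numeral)
  then show ?thesis by simp
qed

lemma finsler_norm_continuous:
  assumes "finsler_norm \<phi>"
  shows "continuous_on UNIV \<phi>"
  using assms unfolding finsler_norm_def by (intro convex_on_continuous) auto

lemma finsler_norm_lower_bound: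
  assumes "finsler_norm \<phi>"
  obtains m where "0 < m" "\<And>x. m * norm x \<le> \<phi> x"
proof -
  have "sphere (0::real^'a) 1 \<noteq> {}" by simp
  then obtain z where z: "z \<in> sphere 0 1" "\<forall>y\<in>sphere 0 1. \<phi> z \<le> \<phi> y"
    using continuous_attains_inf[of "sphere 0 1" \<phi>]
      continuous_on_subset[OF finsler_norm_continuous[OF assms]] by auto
  have "z \<noteq> 0" using z(1) by auto
  then have "0 < \<phi> z" using assms by (simp add: finsler_norm_def)
  moreover have "\<phi> z * norm x \<le> \<phi> x" for x
  proof (cases "x = 0")
    case True
    then show ?thesis using finsler_norm_zero[OF assms] by simp
  next
    case False
    have "\<phi> x = \<phi> (norm x *\<^sub>R ((1 / norm x) *\<^sub>R x))" using False by simp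
    also have "\<dots> = norm x * \<phi> ((1 / norm x) *\<^sub>R x)"
      using assms False unfolding finsler_norm_def by (metis zero_less_norm_iff)
    also have "\<dots> \<ge> norm x * \<phi> z"
      using z(2) False by (intro mult_left_mono) auto
    finally show ?thesis by (simp add: mult.commute)
  qed
  ultimately show ?thesis using that by blast
qed

lemma finsler_norm_compact_ball:
  assumes "finsler_norm \<phi>"
  shows "compact {q. \<phi> q \<le> 1}"
proof -
  obtain m where m: "0 < m" "\<And>x. m * norm x \<le> \<phi> x"
    using finsler_norm_lower_bound[OF assms] by blast
  have "norm q \<le> 1 / m" if "\<phi> q \<le> 1" for q
    using m(1) order_trans[OF m(2) that] by (simp add: field_simps)
  then have "bounded {q. \<phi> q \<le> 1}" by (auto intro: boundedI)
  moreover have "closed {q. \<phi> q \<le> 1}"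
    using finsler_norm_continuous[OF assms] by (intro closed_Collect_le) auto
  ultimately show ?thesis by (simp add: compact_eq_bounded_closed)
qed

lemma SUP_attained:
  fixes f :: "'a::topological_space \<Rightarrow> real"
  assumes "compact S" "S \<noteq> {}" "continuous_on S f"
  shows "\<exists>q\<in>S. (SUP x\<in>S. f x) = f q \<and> (\<forall>x\<in>S. f x \<le> f q)"
proof -
  obtain q where q: "q \<in> S" "\<forall>x\<in>S. f x \<le> f q"
    using continuous_attains_sup[OF assms] by blast
  then have "(SUP x\<in>S. f x) = f q" by (intro cSup_eq_maximum) auto
  then show ?thesis using q by blast
qed

lemma dual_norm_attained:
  assumes "finsler_norm \<phi>"
  obtains q where "\<phi> q \<le> 1" "dual_norm \<phi> p = p \<bullet> q" "\<And>x. \<phi> x \<le> 1 \<Longrightarrow> p \<bullet> x \<le> p \<bullet> q"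
proof -
  let ?B = "{q. \<phi> q \<le> 1}"
  have "0 \<in> ?B" using finsler_norm_zero[OF assms] by simp
  then have "?B \<noteq> {}" by blast
  moreover have "continuous_on ?B (\<lambda>q. p \<bullet> q)" by (intro continuous_intros)
  ultimately have "\<exists>q\<in>?B. (SUP q\<in>?B. p \<bullet> q) = p \<bullet> q \<and> (\<forall>x\<in>?B. p \<bullet> x \<le> p \<bullet> q)"
    by (intro SUP_attained finsler_norm_compact_ball assms)
  then show ?thesis unfolding dual_norm_def[symmetric] using that by blast
qed

lemma dual_norm_upper:
  assumes "finsler_norm \<phi>" "\<phi> q \<le> 1"
  shows "p \<bullet> q \<le> dual_norm \<phi> p"
  using dual_norm_attained[OF assms(1), of p] assms(2) by metis

lemma subdifferential_dual_norm_nonempty: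
  assumes "finsler_norm \<phi>"
  shows "subdifferential (dual_norm \<phi>) p \<noteq> {}"
proof -
  obtain q where q: "\<phi> q \<le> 1" "dual_norm \<phi> p = p \<bullet> q"
    using dual_norm_attained[OF assms] by blast
  have "dual_norm \<phi> p + q \<bullet> (p' - p) \<le> dual_norm \<phi> p'" for p'
    using dual_norm_upper[OF assms q(1), of p'] q(2)
    by (simp add: inner_diff_right inner_commute)
  then show ?thesis unfolding subdifferential_def by blast
qed

lemma subdifferential_dual_norm_compact:
  assumes "finsler_norm \<phi>"
  shows "compact (subdifferential (dual_norm \<phi>) p)"
proof -
  obtain m where m: "0 < m" "\<And>x. m * norm x \<le> \<phi> x"
    using finsler_norm_lower_bound[OF assms] by blast
  have bound: "dual_norm \<phi> r \<le> norm r * (1 / m)" for r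
  proof -
    obtain x where x: "\<phi> x \<le> 1" "dual_norm \<phi> r = r \<bullet> x"
      using dual_norm_attained[OF assms] by blast
    have "norm x \<le> 1 / m"
      using m(1) order_trans[OF m(2) x(1)] by (simp add: field_simps)
    then have "norm r * norm x \<le> norm r * (1 / m)" by (intro mult_left_mono) auto
    then show ?thesis
      unfolding x(2) by (rule order_trans[OF norm_cauchy_schwarz])
  qed
  have "norm q \<le> (norm p + 1) * (1 / m) - dual_norm \<phi> p"
    if q: "q \<in> subdifferential (dual_norm \<phi>) p" for q
  proof -
    have "dual_norm \<phi> p + q \<bullet> ((p + sgn q) - p) \<le> dual_norm \<phi> (p + sgn q)"
      using q unfolding subdifferential_def by blast
    moreover have "q \<bullet> ((p + sgn q) - p) = norm q"
      by (cases "q = 0") (simp_all add: sgn_div_norm dot_square_norm power2_eq_square)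
    moreover have "norm (p + sgn q) \<le> norm p + 1"
      using norm_triangle_ineq[of p "sgn q"] by (simp add: norm_sgn split: if_splits)
    then have "norm (p + sgn q) * (1 / m) \<le> (norm p + 1) * (1 / m)"
      using m(1) by (intro mult_right_mono) auto
    ultimately show ?thesis using bound[of "p + sgn q"] by linarith
  qed
  then have "bounded (subdifferential (dual_norm \<phi>) p)" by (rule boundedI)
  moreover have "closed (subdifferential (dual_norm \<phi>) p)"
    unfolding subdifferential_def
    by (intro closed_Collect_all closed_Collect_le continuous_intros)
  ultimately show ?thesis by (simp add: compact_eq_bounded_closed)
qed

lemma Gstar_attained:
  assumes "finsler_norm \<phi>"
  obtains q where "q \<in> subdifferential (dual_norm \<phi>) p" "Gstar \<phi> p X = (X *v q) \<bullet> q"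
    "\<And>r. r \<in> subdifferential (dual_norm \<phi>) p \<Longrightarrow> (X *v r) \<bullet> r \<le> (X *v q) \<bullet> q"
proof -
  let ?S = "subdifferential (dual_norm \<phi>) p"
  have "continuous_on ?S (\<lambda>q. (X *v q) \<bullet> q)"
    by (intro continuous_on_inner matrix_vector_mult_linear_continuous_on continuous_on_id)
  then have "\<exists>q\<in>?S. (SUP q\<in>?S. (X *v q) \<bullet> q) = (X *v q) \<bullet> q \<and>
      (\<forall>r\<in>?S. (X *v r) \<bullet> r \<le> (X *v q) \<bullet> q)"
    by (intro SUP_attained subdifferential_dual_norm_compact subdifferential_dual_norm_nonempty assms)
  then show ?thesis unfolding Gstar_def[symmetric] using that by blast
qed

end

theory Submission
  imports Defs
begin

text \<open>
  Let \<open>\<phi> - \<eta>\<close> have a local minimum at \<open>x\<^sub>0 \<noteq> 0\<close>, and let \<open>p\<close> and \<open>H\<close> be the gradient and the Hessian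
  of \<open>\<eta>\<close> at \<open>x\<^sub>0\<close>. The claim is that \<open>H q \<bullet> q \<le> 0\<close> for every \<open>q \<in> \<partial>\<phi>\<^sup>*(p)\<close>. The idea is that \<open>\<phi>\<close>
  grows at most linearly, with slope 1, in every such direction \<open>q\<close>, while \<open>\<eta>\<close> starts from \<open>x\<^sub>0\<close>
  with slope at least 1 in that direction. A positive second derivative would then push \<open>\<eta>\<close>
  above \<open>\<phi>\<close>.

  Slope of \<open>\<phi>\<close>: the subgradients of \<open>\<phi>\<^sup>*\<close> lie in the unit ball of \<open>\<phi>\<close>, by a separation argument
  (\<open>subdifferential_dual_norm_le_one\<close>). Hence \<open>\<phi>(x\<^sub>0 + t q) \<le> \<phi>(x\<^sub>0) + t\<close> for \<open>t > 0\<close>, by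
  subadditivity.

  Slope of \<open>\<eta>\<close>: on the ray through \<open>x\<^sub>0\<close> the norm is linear, so touching it from below forces
  \<open>p \<bullet> x\<^sub>0 = \<phi>(x\<^sub>0)\<close> (\<open>finsler_norm_euler_at_touching_point\<close>), and therefore \<open>\<phi>\<^sup>*(p) \<ge> 1\<close>. As
  \<open>\<phi>\<^sup>*(0) = 0\<close>, the subgradient inequality at \<open>0\<close> gives \<open>p \<bullet> q \<ge> \<phi>\<^sup>*(p) \<ge> 1\<close>.

  If \<open>H q \<bullet> q\<close> were positive, \<open>t \<mapsto> \<eta>(x\<^sub>0 + t q) - t\<close> would have nonnegative first and positive
  second derivative at \<open>0\<close>, hence would increase strictly for small \<open>t > 0\<close>
  (\<open>increasing_right_of_second_derivative_pos\<close>). But minimality at \<open>x\<^sub>0\<close> gives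
  \<open>\<eta>(x\<^sub>0 + t q) - \<eta>(x\<^sub>0) \<le> \<phi>(x\<^sub>0 + t q) - \<phi>(x\<^sub>0) \<le> t\<close>.
\<close>

section \<open>Finsler norms and subgradients of the dual norm\<close>

lemma finsler_norm_subadditive:
  assumes "finsler_norm \<phi>"
  shows "\<phi> (x + y) \<le> \<phi> x + \<phi> y"
proof -
  have cvx: "convex_on UNIV \<phi>" and hom: "\<And>c z. 0 < c \<Longrightarrow> \<phi> (c *\<^sub>R z) = c * \<phi> z"
    using assms by (auto simp: finsler_norm_def)
  have "\<phi> ((1 - 1/2) *\<^sub>R (2 *\<^sub>R x) + (1/2) *\<^sub>R (2 *\<^sub>R y))
      \<le> (1 - 1/2) * \<phi> (2 *\<^sub>R x) + (1/2) * \<phi> (2 *\<^sub>R y)"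
    by (rule convex_onD[OF cvx]) auto
  then show ?thesis using hom[of 2 x] hom[of 2 y] by simp
qed

lemma finsler_norm_convex_unit_ball:
  assumes "finsler_norm \<phi>"
  shows "convex {x. \<phi> x \<le> 1}"
proof (rule convexI)
  fix x y and u v :: real
  assume *: "x \<in> {x. \<phi> x \<le> 1}" "y \<in> {x. \<phi> x \<le> 1}" "0 \<le> u" "0 \<le> v" "u + v = 1"
  have "\<phi> (u *\<^sub>R x + v *\<^sub>R y) \<le> u * \<phi> x + v * \<phi> y"
    using assms * unfolding finsler_norm_def convex_on_def by blast
  also have "\<dots> \<le> 1" using * by (intro convex_bound_le) auto
  finally show "u *\<^sub>R x + v *\<^sub>R y \<in> {x. \<phi> x \<le> 1}" by simp
qed

lemma dual_norm_zero:
  assumes "finsler_norm \<phi>"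
  shows "dual_norm \<phi> 0 = 0"
  using dual_norm_attained[OF assms, of 0] by (metis inner_zero_left)

lemma dual_norm_subadditive:
  assumes "finsler_norm \<phi>"
  shows "dual_norm \<phi> (p + r) \<le> dual_norm \<phi> p + dual_norm \<phi> r"
proof -
  obtain q where q: "\<phi> q \<le> 1" "dual_norm \<phi> (p + r) = (p + r) \<bullet> q"
    using dual_norm_attained[OF assms] by blast
  show ?thesis
    using dual_norm_upper[OF assms q(1), of p] dual_norm_upper[OF assms q(1), of r] q(2)
    by (simp add: inner_add_left)
qed

text \<open>
  This is the bipolar theorem for the convex set \<open>{\<phi> \<le> 1}\<close>: a point outside it is strictly
  separated from it by some \<open>r\<close>, and \<open>\<phi>\<^sup>*(r)\<close> is the maximum of \<open>r\<close> over the set.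
\<close>

lemma finsler_norm_le_one_if_dual_bound:
  assumes "finsler_norm \<phi>" and bound: "\<And>r. r \<bullet> q \<le> dual_norm \<phi> r"
  shows "\<phi> q \<le> 1"
proof (rule ccontr)
  let ?B = "{x. \<phi> x \<le> 1}"
  assume "\<not> \<phi> q \<le> 1"
  then have "q \<notin> ?B" by simp
  moreover have "convex ?B"
    by (rule finsler_norm_convex_unit_ball[OF assms(1)])
  moreover have "closed ?B"
    by (intro compact_imp_closed finsler_norm_compact_ball assms(1))
  ultimately obtain a b where ab: "a \<bullet> q < b" "\<And>x. x \<in> ?B \<Longrightarrow> b < a \<bullet> x"
    using separating_hyperplane_closed_point[of ?B q] by blast
  obtain x where x: "\<phi> x \<le> 1" "dual_norm \<phi> (- a) = (- a) \<bullet> x"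
    using dual_norm_attained[OF assms(1)] by blast
  show False using bound[of "- a"] x ab(1) ab(2)[of x] by simp
qed

text \<open>
  Since \<open>\<phi>\<^sup>*\<close> is subadditive, a subgradient at any point is dominated by \<open>\<phi>\<^sup>*\<close> itself.
\<close>

lemma subdifferential_dual_norm_le_one:
  assumes "finsler_norm \<phi>" "q \<in> subdifferential (dual_norm \<phi>) p"
  shows "\<phi> q \<le> 1"
proof (rule finsler_norm_le_one_if_dual_bound[OF assms(1)])
  fix r
  have "dual_norm \<phi> p + q \<bullet> ((p + r) - p) \<le> dual_norm \<phi> (p + r)"
    using assms(2) unfolding subdifferential_def by blast
  then show "r \<bullet> q \<le> dual_norm \<phi> r"
    using dual_norm_subadditive[OF assms(1), of p r] by (simp add: inner_commute)
qed

lemma dual_norm_le_inner_subgradient: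
  assumes "finsler_norm \<phi>" "q \<in> subdifferential (dual_norm \<phi>) p"
  shows "dual_norm \<phi> p \<le> p \<bullet> q"
proof -
  have "dual_norm \<phi> p + q \<bullet> (0 - p) \<le> dual_norm \<phi> 0"
    using assms(2) unfolding subdifferential_def by blast
  then show ?thesis using dual_norm_zero[OF assms(1)] by (simp add: inner_commute)
qed

section \<open>Derivatives along lines\<close>

lemma GDERIV_imp_line_derivative:
  assumes "GDERIV f (x + t *\<^sub>R v) :> D"
  shows "((\<lambda>s. f (x + s *\<^sub>R v)) has_real_derivative D \<bullet> v) (at t)"
proof -
  have "((\<lambda>s. x + s *\<^sub>R v) has_derivative (\<lambda>h. h *\<^sub>R v)) (at t)"
    by (auto intro!: derivative_eq_intros)
  moreover have "(f has_derivative (\<lambda>h. h \<bullet> D)) (at (x + t *\<^sub>R v))"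
    using assms by (simp add: gderiv_def)
  ultimately have "((\<lambda>s. f (x + s *\<^sub>R v)) has_derivative (\<lambda>h. (h *\<^sub>R v) \<bullet> D)) (at t)"
    by (rule has_derivative_compose)
  moreover have "(\<lambda>h. (h *\<^sub>R v) \<bullet> D) = (*) (D \<bullet> v)"
    by (auto simp: inner_commute mult.commute)
  ultimately show ?thesis by (simp add: has_field_derivative_def)
qed

lemma smooth_on_GDERIV_gradient:
  assumes "smooth_on \<eta> U" "x \<in> U"
  shows "GDERIV \<eta> x :> gradient \<eta> x"
proof -
  have "Ck_on (Suc 0) \<eta> U" using assms(1) by (simp add: smooth_on_def del: Ck_on.simps)
  then obtain g where "GDERIV \<eta> x :> g" using assms(2) by auto
  then show ?thesis using gradient_eqI by metis
qed

text \<open>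
  Smoothness supplies, order by order, some gradient field whose components are differentiable.
  On \<open>U\<close> it agrees with \<open>gradient \<eta>\<close>; as \<open>U\<close> is open, the derivative carries over, and the Hessian,
  being the Jacobian matrix of \<open>gradient \<eta>\<close>, represents it.
\<close>

lemma smooth_on_gradient_has_derivative_hessian:
  assumes "open U" "smooth_on \<eta> U" "x \<in> U"
  shows "(gradient \<eta> has_derivative (*v) (hessian \<eta> x)) (at x)"
proof -
  have "Ck_on (Suc (Suc 0)) \<eta> U" using assms(2) by (simp add: smooth_on_def del: Ck_on.simps)
  then obtain g where g: "\<forall>y\<in>U. GDERIV \<eta> y :> g y" "\<forall>i. Ck_on (Suc 0) (\<lambda>y. g y $ i) U"
    by (auto simp del: Ck_on.simps simp: Ck_on.simps(2)[of "Suc 0"])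
  have "\<forall>i. \<exists>D. GDERIV (\<lambda>y. g y $ i) x :> D"
    using g(2) assms(3) unfolding Ck_on.simps(2) by blast
  then obtain D where D: "\<And>i. GDERIV (\<lambda>y. g y $ i) x :> D i" by metis
  have "(g has_derivative (\<lambda>h. \<chi> i. h \<bullet> D i)) (at x)"
    using D by (subst has_derivative_componentwise_within)
      (auto simp: gderiv_def Basis_vec_def inner_axis)
  moreover have "g y = gradient \<eta> y" if "y \<in> U" for y
    using g(1) that gradient_eqI by metis
  ultimately have "(gradient \<eta> has_derivative (\<lambda>h. \<chi> i. h \<bullet> D i)) (at x)"
    by (rule has_derivative_transform_within_open[OF _ assms(1,3)])
  then have "gradient \<eta> differentiable (at x)" by (rule differentiableI)
  then show ?thesis
    unfolding hessian_def by (simp add: jacobian_works)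
qed

text \<open>
  The sign of \<open>c\<close> makes \<open>m'\<close> positive just to the right of \<open>0\<close>, even if \<open>m' 0 = 0\<close>, and the mean
  value theorem does the rest.
\<close>

lemma increasing_right_of_second_derivative_pos:
  fixes m m' :: "real \<Rightarrow> real"
  assumes "0 < d" and m: "\<And>t. \<bar>t\<bar> < d \<Longrightarrow> (m has_real_derivative m' t) (at t)"
    and m': "(m' has_real_derivative c) (at 0)" and "0 \<le> m' 0" "0 < c"
  obtains e where "0 < e" "\<And>t. 0 < t \<Longrightarrow> t < e \<Longrightarrow> m 0 < m t"
proof -
  obtain e where e: "0 < e" "\<And>h. 0 < h \<Longrightarrow> h < e \<Longrightarrow> m' 0 < m' (0 + h)"
    using DERIV_pos_inc_right[OF m' \<open>0 < c\<close>] by blast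
  have "m 0 < m t" if t: "0 < t" "t < min d e" for t
  proof (rule DERIV_pos_imp_increasing_open[OF t(1)])
    fix s assume s: "0 < s" "s < t"
    then have "0 < m' s" using e(2)[of s] t(2) \<open>0 \<le> m' 0\<close> by simp
    then show "\<exists>y. DERIV m s :> y \<and> 0 < y" using m[of s] s t(2) by auto
  next
    show "continuous_on {0..t} m"
      using t(2) by (intro continuous_at_imp_continuous_on ballI DERIV_isCont[OF m]) auto
  qed
  then show ?thesis using that[of "min d e"] e(1) \<open>0 < d\<close> by simp
qed

section \<open>Test functions touching a Finsler norm from below\<close>

text \<open>
  A Finsler norm is linear on the ray through \<open>x\<close>. The restriction of \<open>\<phi> - \<eta>\<close> to this ray is
  therefore differentiable at its local minimum \<open>x\<close>, and the vanishing of its derivative is Euler's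
  identity for the gradient of \<open>\<eta>\<close>.
\<close>

lemma finsler_norm_euler_at_touching_point:
  assumes "finsler_norm \<phi>" "GDERIV \<eta> x :> p" "has_local_min_at (\<lambda>y. \<phi> y - \<eta> y) x"
  shows "p \<bullet> x = \<phi> x"
proof -
  obtain d where d: "0 < d" "\<And>y. dist y x < d \<Longrightarrow> \<phi> x - \<eta> x \<le> \<phi> y - \<eta> y"
    using assms(3) unfolding has_local_min_at_def eventually_nhds_metric by blast
  have hom: "\<phi> (x + s *\<^sub>R x) = (1 + s) * \<phi> x" if "\<bar>s\<bar> < 1" for s
  proof -
    have "0 < 1 + s" using that by linarith
    then have "\<phi> ((1 + s) *\<^sub>R x) = (1 + s) * \<phi> x"
      using assms(1) unfolding finsler_norm_def by blast
    then show ?thesis by (simp add: algebra_simps)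
  qed
  have "((\<lambda>s. \<eta> (x + s *\<^sub>R x)) has_real_derivative p \<bullet> x) (at 0)"
    by (rule GDERIV_imp_line_derivative) (use assms(2) in simp)
  then have "((\<lambda>s. (1 + s) * \<phi> x - \<eta> (x + s *\<^sub>R x)) has_real_derivative \<phi> x - p \<bullet> x) (at 0)"
    by (auto intro!: derivative_eq_intros)
  \<comment> \<open>For these \<open>s\<close> the point stays in the neighbourhood of \<open>x\<close> and on the open ray from the origin
      through \<open>x\<close>.\<close>
  moreover have "0 < min 1 (d / (norm x + 1))"
    using d(1) by (simp add: add_nonneg_pos)
  moreover have "(1 + 0) * \<phi> x - \<eta> (x + 0 *\<^sub>R x) \<le> (1 + s) * \<phi> x - \<eta> (x + s *\<^sub>R x)"
    if s: "\<bar>0 - s\<bar> < min 1 (d / (norm x + 1))" for s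
  proof -
    have "\<bar>s\<bar> * (norm x + 1) < d"
      using s by (simp add: pos_less_divide_eq add_nonneg_pos)
    then have "dist (x + s *\<^sub>R x) x < d" by (simp add: dist_norm algebra_simps)
    then show ?thesis using d(2)[of "x + s *\<^sub>R x"] hom[of s] s by simp
  qed
  ultimately have "\<phi> x - p \<bullet> x = 0" by (metis (no_types, lifting) DERIV_local_min)
  then show ?thesis by simp
qed

lemma dual_norm_ge_one_at_touching_point:
  assumes "finsler_norm \<phi>" "GDERIV \<eta> x :> p" "has_local_min_at (\<lambda>y. \<phi> y - \<eta> y) x" "x \<noteq> 0"
  shows "1 \<le> dual_norm \<phi> p"
proof -
  have pos: "0 < \<phi> x" and hom: "\<And>c y. 0 < c \<Longrightarrow> \<phi> (c *\<^sub>R y) = c * \<phi> y"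
    using assms(1,4) by (auto simp: finsler_norm_def)
  \<comment> \<open>By Euler's identity, normalising \<open>x\<close> gives a competitor with value 1 in the maximum.\<close>
  have "p \<bullet> ((1 / \<phi> x) *\<^sub>R x) = 1"
    using finsler_norm_euler_at_touching_point[OF assms(1-3)] pos by simp
  moreover have "\<phi> ((1 / \<phi> x) *\<^sub>R x) \<le> 1" using hom[of "1 / \<phi> x" x] pos by simp
  ultimately show ?thesis using dual_norm_upper[OF assms(1)] by metis
qed

text \<open>
  Along the half-line from \<open>x\<close> in direction \<open>q\<close>, the norm grows at most like \<open>t\<close>, so
  \<open>\<eta> (x + t *\<^sub>R q) - t\<close> cannot exceed its value at \<open>t = 0\<close> for small \<open>t\<close>; a positive second
  derivative would make it do so, because its first derivative at \<open>0\<close> is nonnegative.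
\<close>

lemma hessian_nonpos_along_subgradient:
  assumes fin: "finsler_norm \<phi>" and "x \<noteq> 0" and U: "open U" "x \<in> U" "smooth_on \<eta> U"
    and min: "has_local_min_at (\<lambda>y. \<phi> y - \<eta> y) x"
    and q: "q \<in> subdifferential (dual_norm \<phi>) (gradient \<eta> x)"
  shows "(hessian \<eta> x *v q) \<bullet> q \<le> 0"
proof (rule ccontr)
  let ?m = "\<lambda>t. \<eta> (x + t *\<^sub>R q) - t"
  let ?m' = "\<lambda>t. gradient \<eta> (x + t *\<^sub>R q) \<bullet> q - 1"
  assume "\<not> (hessian \<eta> x *v q) \<bullet> q \<le> 0"
  then have pos: "0 < (hessian \<eta> x *v q) \<bullet> q" by simp
  obtain d where d: "0 < d" "\<And>y. dist y x < d \<Longrightarrow> y \<in> U"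
    "\<And>y. dist y x < d \<Longrightarrow> \<phi> x - \<eta> x \<le> \<phi> y - \<eta> y"
  proof -
    have "\<forall>\<^sub>F y in nhds x. y \<in> U \<and> \<phi> x - \<eta> x \<le> \<phi> y - \<eta> y"
      using min U(1,2) unfolding has_local_min_at_def
      by (intro eventually_conj eventually_nhds_in_open) auto
    then show ?thesis using that unfolding eventually_nhds_metric by blast
  qed
  define \<delta> where "\<delta> = d / (norm q + 1)"
  have \<delta>: "0 < \<delta>" using d(1) by (simp add: \<delta>_def add_nonneg_pos)
  have near: "dist (x + t *\<^sub>R q) x < d" if "\<bar>t\<bar> < \<delta>" for t
  proof -
    have "\<bar>t\<bar> * (norm q + 1) < d"
      using that by (simp add: \<delta>_def pos_less_divide_eq add_nonneg_pos)
    then show ?thesis by (simp add: dist_norm algebra_simps)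
  qed
  have "(?m has_real_derivative ?m' t) (at t)" if "\<bar>t\<bar> < \<delta>" for t
    using GDERIV_imp_line_derivative[OF smooth_on_GDERIV_gradient[OF U(3) d(2)[OF near[OF that]]]]
    by (auto intro!: derivative_eq_intros)
  moreover have "(?m' has_real_derivative (hessian \<eta> x *v q) \<bullet> q) (at 0)"
  proof -
    have "((\<lambda>t. x + t *\<^sub>R q) has_derivative (\<lambda>h. h *\<^sub>R q)) (at 0)"
      by (auto intro!: derivative_eq_intros)
    moreover have "(gradient \<eta> has_derivative (*v) (hessian \<eta> x)) (at (x + 0 *\<^sub>R q))"
      using smooth_on_gradient_has_derivative_hessian[OF U(1,3,2)] by simp
    ultimately have "((\<lambda>t. gradient \<eta> (x + t *\<^sub>R q)) has_derivative
        (\<lambda>h. hessian \<eta> x *v (h *\<^sub>R q))) (at 0)"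
      by (rule has_derivative_compose)
    then have "(?m' has_derivative (\<lambda>h. (hessian \<eta> x *v (h *\<^sub>R q)) \<bullet> q)) (at 0)"
      by (auto intro!: derivative_eq_intros)
    moreover have "(\<lambda>h. (hessian \<eta> x *v (h *\<^sub>R q)) \<bullet> q) = (*) ((hessian \<eta> x *v q) \<bullet> q)"
      by (auto simp: matrix_vector_mult_scaleR mult.commute)
    ultimately show ?thesis by (simp add: has_field_derivative_def)
  qed
  moreover have "0 \<le> ?m' 0"
    using dual_norm_le_inner_subgradient[OF fin q]
      dual_norm_ge_one_at_touching_point[OF fin smooth_on_GDERIV_gradient[OF U(3,2)] min \<open>x \<noteq> 0\<close>]
    by simp
  ultimately obtain e where e: "0 < e" "\<And>t. 0 < t \<Longrightarrow> t < e \<Longrightarrow> ?m 0 < ?m t"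
    using increasing_right_of_second_derivative_pos[OF \<delta>, of ?m ?m'] pos by blast
  obtain t where t: "0 < t" "t < min \<delta> e" using \<delta> e(1) by (meson dense min_less_iff_conj)
  have "\<eta> (x + t *\<^sub>R q) - \<eta> x \<le> \<phi> (x + t *\<^sub>R q) - \<phi> x"
    using d(3)[OF near[of t]] t by simp
  also have "\<dots> \<le> \<phi> (t *\<^sub>R q)" using finsler_norm_subadditive[OF fin, of x "t *\<^sub>R q"] by simp
  also have "\<dots> = t * \<phi> q" using fin t(1) by (simp add: finsler_norm_def)
  also have "\<dots> \<le> t"
    using mult_left_mono[OF subdifferential_dual_norm_le_one[OF fin q], of t] t(1) by simp
  finally show False using e(2)[of t] t by simp
qed

theorem proposition1:
  fixes \<phi> :: "real^'n \<Rightarrow> real"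
  assumes "finsler_norm \<phi>"
  shows "viscosity_nonneg (\<lambda>p X. - Gstar \<phi> p X) \<phi> (UNIV - {0})"
  unfolding viscosity_nonneg_def
proof (intro ballI allI impI)
  fix x \<eta> U
  assume x: "x \<in> UNIV - {0}"
    and \<eta>: "open U \<and> x \<in> U \<and> smooth_on \<eta> U \<and> has_local_min_at (\<lambda>y. \<phi> y - \<eta> y) x"
  obtain q where q: "q \<in> subdifferential (dual_norm \<phi>) (gradient \<eta> x)"
    "Gstar \<phi> (gradient \<eta> x) (hessian \<eta> x) = (hessian \<eta> x *v q) \<bullet> q"
    using Gstar_attained[OF assms] by blast
  have "(hessian \<eta> x *v q) \<bullet> q \<le> 0"
    using hessian_nonpos_along_subgradient[OF assms _ _ _ _ _ q(1)] x \<eta> by blast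
  then show "0 \<le> - Gstar \<phi> (gradient \<eta> x) (hessian \<eta> x)" using q(2) by simp
qed

end
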